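(* For any integer $n\geq 3$, $\tau(C_n\cup C_3)\geq 15$. Moreover, $\tau(2C_3)=\beta(2C_3)=15$.
   Context: Graphs are finite and simple, not necessarily connected. For a graph $G$ with $m$ edges and a bijection $f: E(G)\to\{1,2,\dots,m\}$, let $\phi_f(v)$ be the sum of $f(e)$ over all edges $e$ incident to the vertex $v$. The bijection $f$ is an antimagic labeling of $G$ if $\phi_f(u)\neq\phi_f(v)$ for all pairs of distinct vertices $u,v$; $G$ is antimagic if it admits an antimagic labeling. $P_j$ is the path on $j$ vertices, $C_j$ the cycle on $j$ vertices. $G\cup H$ denotes disjoint union, and $tG$ the disjoint union of $t$ copies of $G$. If $G$ is antimagic, $\tau(G)$ is the maximum non-negative integer $t$ such that $G\cup t'P_3$ is antimagic for all integers $0\leq t'\leq t$; if $G$ is not antimagic, $\tau(G)=-\infty$. An edge is internal if both of its ends are non-leaf vertices. For a graph $G$ without isolated vertices and without $P_2$ as a component, having $n$ vertices, $m$ edges, $k$ internal edges, and $t'$ components isomorphic to $P_3$, $$\beta(G) = \left\lfloor\min \left\{ (3 + 2\sqrt{2})(m -n)+(1 + \sqrt{2})\left(m +\tfrac{1}{2}\right), \ 2m + 5(k-t') +1 \right\} \right\rfloor.$$ *)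

theory Defs
  imports Complex_Main "HOL-Library.Extended_Real"
begin

text \<open>The record itself carries no well-formedness condition; see \<open>simple_graph\<close>.\<close>

record 'a ugraph =
  verts :: "'a set"
  edges :: "'a set set"

definition simple_graph :: "'a ugraph \<Rightarrow> bool" where
  "simple_graph G \<longleftrightarrow> finite (verts G) \<and> (\<forall>e\<in>edges G. e \<subseteq> verts G \<and> card e = 2)"

definition path_graph :: "nat \<Rightarrow> nat ugraph" where
  "path_graph j = \<lparr>verts = {..<j}, edges = {{i, Suc i} | i. Suc i < j}\<rparr>"

text \<open>A cycle only for \<open>j \<ge> 3\<close>.\<close>

definition cycle_graph :: "nat \<Rightarrow> nat ugraph" where
  "cycle_graph j = \<lparr>verts = {..<j}, edges = {{i, Suc i mod j} | i. i < j}\<rparr>"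

definition disj_union :: "'a ugraph \<Rightarrow> 'b ugraph \<Rightarrow> ('a + 'b) ugraph" where
  "disj_union G H =
     \<lparr>verts = Inl ` verts G \<union> Inr ` verts H,
      edges = (`) Inl ` edges G \<union> (`) Inr ` edges H\<rparr>"

definition copies :: "nat \<Rightarrow> 'a ugraph \<Rightarrow> (nat \<times> 'a) ugraph" where
  "copies t G =
     \<lparr>verts = {..<t} \<times> verts G,
      edges = {Pair i ` e | i e. i < t \<and> e \<in> edges G}\<rparr>"

lemma simple_graph_path_graph: "simple_graph (path_graph j)"
  by (auto simp: simple_graph_def path_graph_def)

lemma simple_graph_cycle_graph:
  assumes "j \<ge> 3"
  shows "simple_graph (cycle_graph j)"
proof -
  have "i \<noteq> Suc i mod j" if "i < j" for i
    using that assms by (cases "Suc i = j") auto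
  then show ?thesis
    using assms by (auto simp: simple_graph_def cycle_graph_def card_2_iff)
qed

lemma simple_graph_disj_union:
  "simple_graph G \<Longrightarrow> simple_graph H \<Longrightarrow> simple_graph (disj_union G H)"
  unfolding simple_graph_def disj_union_def
  by (simp add: ball_Un card_image image_mono le_supI1 le_supI2)

lemma simple_graph_copies: "simple_graph G \<Longrightarrow> simple_graph (copies t G)"
  by (fastforce simp: simple_graph_def copies_def card_image inj_on_def)

definition vertex_sum :: "'a ugraph \<Rightarrow> ('a set \<Rightarrow> nat) \<Rightarrow> 'a \<Rightarrow> nat" where
  "vertex_sum G f v = (\<Sum>e | e \<in> edges G \<and> v \<in> e. f e)"

definition antimagic_labeling :: "'a ugraph \<Rightarrow> ('a set \<Rightarrow> nat) \<Rightarrow> bool" where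
  "antimagic_labeling G f \<longleftrightarrow>
     bij_betw f (edges G) {1..card (edges G)} \<and>
     (\<forall>u\<in>verts G. \<forall>v\<in>verts G. u \<noteq> v \<longrightarrow> vertex_sum G f u \<noteq> vertex_sum G f v)"

definition antimagic :: "'a ugraph \<Rightarrow> bool" where
  "antimagic G \<longleftrightarrow> (\<exists>f. antimagic_labeling G f)"

text \<open>\<open>GREATEST\<close> is unspecified when there is no maximum, so a bound on \<open>tau G\<close> for an
  antimagic \<open>G\<close> can only be derived by showing that the maximum exists.\<close>

definition tau :: "'a ugraph \<Rightarrow> ereal" where
  "tau G =
     (if antimagic G
      then ereal (real (GREATEST t. \<forall>t'\<le>t. antimagic (disj_union G (copies t' (path_graph 3)))))
      else - \<infinity>)"

definition degree :: "'a ugraph \<Rightarrow> 'a \<Rightarrow> nat" where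
  "degree G v = card {e \<in> edges G. v \<in> e}"

definition leaf :: "'a ugraph \<Rightarrow> 'a \<Rightarrow> bool" where
  "leaf G v \<longleftrightarrow> v \<in> verts G \<and> degree G v = 1"

definition internal_edges :: "'a ugraph \<Rightarrow> 'a set set" where
  "internal_edges G = {e \<in> edges G. \<forall>v\<in>e. \<not> leaf G v}"

definition graph_iso :: "'a ugraph \<Rightarrow> 'b ugraph \<Rightarrow> bool" where
  "graph_iso G H \<longleftrightarrow>
     (\<exists>h. bij_betw h (verts G) (verts H) \<and> edges H = (`) h ` edges G)"

definition reachable :: "'a ugraph \<Rightarrow> 'a \<Rightarrow> 'a \<Rightarrow> bool" where
  "reachable G = (\<lambda>u v. {u, v} \<in> edges G)\<^sup>*\<^sup>*"

definition induced_subgraph :: "'a ugraph \<Rightarrow> 'a set \<Rightarrow> 'a ugraph" where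
  "induced_subgraph G S = \<lparr>verts = S, edges = {e \<in> edges G. e \<subseteq> S}\<rparr>"

definition graph_components :: "'a ugraph \<Rightarrow> 'a ugraph set" where
  "graph_components G =
     {induced_subgraph G {v \<in> verts G. reachable G u v} | u. u \<in> verts G}"

text \<open>Only meaningful for simple graphs with no isolated vertex and no component that is a
  single edge. The differences are taken in \<open>real\<close>.\<close>

definition beta :: "'a ugraph \<Rightarrow> int" where
  "beta G =
     (let n = real (card (verts G));
          m = real (card (edges G));
          k = real (card (internal_edges G));
          t' = real (card {C \<in> graph_components G. graph_iso C (path_graph 3)})
      in \<lfloor>min ((3 + 2 * sqrt 2) * (m - n) + (1 + sqrt 2) * (m + 1/2))
              (2 * m + 5 * (k - t') + 1)\<rfloor>)"

end

theory Submission imports Defs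
begin

text \<open>
  \<^emph>\<open>Upper bound.\<close> With \<open>N\<close> edges, the vertex sums of an antimagic labeling without isolated
  vertices are distinct positive integers, so on \<open>V\<close> vertices they add up to at least
  \<open>V (V + 1) / 2\<close>; by the handshake identity they add up to \<open>N (N + 1)\<close>. If \<open>G\<close> has \<open>m\<close> vertices
  and \<open>m\<close> edges, then adding \<open>t\<close> paths gives \<open>V = m + 3 t\<close> and \<open>N = m + 2 t\<close>, and comparing the
  two totals bounds \<open>t\<close> by a multiple of \<open>m\<close> (\<open>antimagic_card_bound\<close>, \<open>path3_copies_bound\<close>). For
  two triangles and \<open>t = 16\<close> the totals are \<open>54 * 55 / 2 = 1485\<close> and \<open>38 * 39 = 1482\<close>, so 16
  copies are one too many. For the other cycle lengths some bound is needed to know that the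
  maximum in the definition of \<open>tau\<close> exists.

  \<^emph>\<open>Lower bound.\<close> For each \<open>t \<le> 15\<close> a labeling of two triangles and \<open>t\<close> paths is given
  explicitly (\<open>seeds\<close>), chosen so that the largest label \<open>N\<close> lies on the first triangle and one of
  its ends \<open>v\<close> has the largest of all vertex sums. Such a labeling can be lengthened: subdivide the
  edge labeled \<open>N\<close>, so that the part away from \<open>v\<close> keeps the label \<open>N\<close> and the part at \<open>v\<close>
  gets \<open>N + 1\<close>. The sum at \<open>v\<close> grows by one, so it still exceeds all other old sums, and it is
  at most \<open>2 N\<close>, while the new vertex gets \<open>2 N + 1\<close>. So all sums stay distinct, and the new
  vertex is an end of the new largest edge and has the largest sum; the step can be repeated
  for ever (\<open>growable_step\<close>), which reaches every cycle length.

  Labelings are handled as plain lists of labels and lists of vertex sums, and \<open>sum_profile\<close>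
  carries them over to the graphs.
\<close>

section \<open>Labelings as lists\<close>

text \<open>
  The edges and the vertices of \<open>G\<close> can be listed such that giving the edges the labels \<open>ls\<close>, in
  this order, gives the vertices the sums \<open>ss\<close>. The labels are arbitrary numbers here, with
  repetitions allowed: constant labels yield degrees and, through the lengths of the two lists,
  the numbers of edges and vertices.
\<close>

definition sum_profile :: "'a ugraph \<Rightarrow> nat list \<Rightarrow> nat list \<Rightarrow> bool" where
  "sum_profile G ls ss \<longleftrightarrow>
     (\<exists>es vs. distinct es \<and> set es = edges G \<and> distinct vs \<and> set vs = verts G \<and>
        length es = length ls \<and> (\<forall>f. map f es = ls \<longrightarrow> map (vertex_sum G f) vs = ss))"

lemma ex_map_eq:
  assumes "distinct xs" "length xs = length ys"
  shows "\<exists>f. map f xs = ys"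
proof
  show "map (\<lambda>x. the (map_of (zip xs ys) x)) xs = ys"
    using assms by (auto intro!: nth_equalityI simp: map_of_zip_nth)
qed

lemma sum_profileE:
  assumes "sum_profile G ls ss"
  obtains es vs f where "distinct es" "set es = edges G" "distinct vs" "set vs = verts G"
    "map f es = ls" "map (vertex_sum G f) vs = ss"
proof -
  obtain es vs where *: "distinct es" "set es = edges G" "distinct vs" "set vs = verts G"
      "length es = length ls" "\<And>f. map f es = ls \<Longrightarrow> map (vertex_sum G f) vs = ss"
    using assms unfolding sum_profile_def by blast
  obtain f where "map f es = ls" using ex_map_eq[OF *(1,5)] by blast
  with * that show ?thesis by blast
qed

lemma sum_profile_card:
  assumes "sum_profile G ls ss"
  shows "card (edges G) = length ls" "card (verts G) = length ss"
  using assms by (auto elim!: sum_profileE simp flip: distinct_card)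

lemma antimagic_if_sum_profile:
  assumes "sum_profile G ls ss" "distinct ls" "set ls = {1..length ls}" "distinct ss"
  shows "antimagic G"
proof -
  obtain es vs f where *: "distinct es" "set es = edges G" "distinct vs" "set vs = verts G"
      and f: "map f es = ls" "map (vertex_sum G f) vs = ss"
    using sum_profileE[OF assms(1)] .
  have "inj_on f (edges G)" "f ` edges G = set ls"
    using f(1) assms(2) by (auto simp: distinct_map simp flip: *(2))
  moreover have "inj_on (vertex_sum G f) (verts G)"
    using f(2) assms(4) by (auto simp: distinct_map simp flip: *(4))
  ultimately have "antimagic_labeling G f"
    using assms(3) sum_profile_card(1)[OF assms(1)]
    by (auto simp: antimagic_labeling_def bij_betw_def dest: inj_onD)
  then show ?thesis by (auto simp: antimagic_def)
qed

lemma degrees_if_sum_profile: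
  assumes "sum_profile G ls ss" "set ls \<subseteq> {1}"
  shows "degree G ` verts G = set ss"
proof -
  obtain es vs f where *: "distinct es" "set es = edges G" "distinct vs" "set vs = verts G"
      and f: "map f es = ls" "map (vertex_sum G f) vs = ss"
    using sum_profileE[OF assms(1)] .
  have "f e = 1" if "e \<in> edges G" for e
    using that assms(2) by (auto simp flip: *(2) f(1))
  then have "vertex_sum G f v = degree G v" for v
    by (simp add: vertex_sum_def degree_def)
  then show ?thesis using f(2) *(4) by (metis (no_types, lifting) image_cong list.set_map)
qed

text \<open>
  Profiles of vertex-disjoint pieces are concatenated. The pieces are given through injections, so
  that both \<^const>\<open>disj_union\<close> and the recursion of \<^const>\<open>copies\<close> on the number of copies
  are instances.
\<close>

lemma sum_profile_union:
  assumes simple: "simple_graph G1" "simple_graph G2"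
    and inj: "inj h1" "inj h2" and disj: "h1 ` verts G1 \<inter> h2 ` verts G2 = {}"
    and G: "verts G = h1 ` verts G1 \<union> h2 ` verts G2"
           "edges G = (`) h1 ` edges G1 \<union> (`) h2 ` edges G2"
    and profiles: "sum_profile G1 ls1 ss1" "sum_profile G2 ls2 ss2"
  shows "sum_profile G (ls1 @ ls2) (ss1 @ ss2)"
proof -
  obtain es1 vs1 where 1: "distinct es1" "set es1 = edges G1" "distinct vs1" "set vs1 = verts G1"
      "length es1 = length ls1" "\<And>f. map f es1 = ls1 \<Longrightarrow> map (vertex_sum G1 f) vs1 = ss1"
    using profiles(1) unfolding sum_profile_def by blast
  obtain es2 vs2 where 2: "distinct es2" "set es2 = edges G2" "distinct vs2" "set vs2 = verts G2"
      "length es2 = length ls2" "\<And>f. map f es2 = ls2 \<Longrightarrow> map (vertex_sum G2 f) vs2 = ss2"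
    using profiles(2) unfolding sum_profile_def by blast
  let ?es = "map ((`) h1) es1 @ map ((`) h2) es2" and ?vs = "map h1 vs1 @ map h2 vs2"
  have sub: "e \<subseteq> verts G1 \<and> e \<noteq> {}" if "e \<in> edges G1" for e
    using that simple(1) by (auto simp: simple_graph_def)
  have sub': "e \<subseteq> verts G2 \<and> e \<noteq> {}" if "e \<in> edges G2" for e
    using that simple(2) by (auto simp: simple_graph_def)
  have inj_im: "inj_on ((`) h1) A" "inj_on ((`) h2) B" for A B
    using inj by (auto simp: inj_on_def inj_image_eq_iff)
  have ne: "h1 ` e \<noteq> h2 ` e'" if "e \<in> edges G1" "e' \<in> edges G2" for e e'
    using sub[OF that(1)] sub'[OF that(2)] disj by blast
  have es: "distinct ?es" "set ?es = edges G"
    using 1 2 inj_im ne by (auto simp: distinct_map G)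
  have vs: "distinct ?vs" "set ?vs = verts G"
    using 1 2 inj disj by (auto simp: distinct_map G intro: inj_on_subset)
  have notin1: "h1 v \<notin> h2 ` e" if "v \<in> verts G1" "e \<in> edges G2" for v e
    using that disj sub' by blast
  have notin2: "h2 v \<notin> h1 ` e" if "v \<in> verts G2" "e \<in> edges G1" for v e
    using that disj sub by blast
  have vs1: "vertex_sum G f (h1 v) = vertex_sum G1 (\<lambda>e. f (h1 ` e)) v" if "v \<in> verts G1" for f v
  proof -
    have "{e \<in> edges G. h1 v \<in> e} = (`) h1 ` {e \<in> edges G1. v \<in> e}"
      unfolding G using inj_image_mem_iff[OF inj(1), of v] notin1[OF that] by blast
    then show ?thesis
      by (simp add: vertex_sum_def sum.reindex[OF inj_im(1)])
  qed
  have vs2: "vertex_sum G f (h2 v) = vertex_sum G2 (\<lambda>e. f (h2 ` e)) v" if "v \<in> verts G2" for f v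
  proof -
    have "{e \<in> edges G. h2 v \<in> e} = (`) h2 ` {e \<in> edges G2. v \<in> e}"
      unfolding G using inj_image_mem_iff[OF inj(2), of v] notin2[OF that] by blast
    then show ?thesis
      by (simp add: vertex_sum_def sum.reindex[OF inj_im(2)])
  qed
  have "map (vertex_sum G f) ?vs = ss1 @ ss2" if "map f ?es = ls1 @ ls2" for f
  proof -
    have "map (\<lambda>e. f (h1 ` e)) es1 = ls1" "map (\<lambda>e. f (h2 ` e)) es2 = ls2"
      using that 1(5) 2(5) by (auto simp: comp_def)
    from 1(6)[OF this(1)] 2(6)[OF this(2)] show ?thesis
      by (auto simp: vs1 vs2 1(4) 2(4) intro!: map_cong)
  qed
  with es vs 1(5) 2(5) show ?thesis
    unfolding sum_profile_def by (intro exI[of _ ?es] exI[of _ ?vs]) auto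
qed

lemma sum_profile_disj_union:
  assumes "simple_graph G" "simple_graph H" "sum_profile G ls ss" "sum_profile H ls' ss'"
  shows "sum_profile (disj_union G H) (ls @ ls') (ss @ ss')"
  using assms by (intro sum_profile_union[of G H Inl Inr]) (auto simp: disj_union_def)

lemma sum_profile_copies:
  assumes "simple_graph G" "\<And>i. i < t \<Longrightarrow> sum_profile G (L i) (S i)"
  shows "sum_profile (copies t G) (concat (map L [0..<t])) (concat (map S [0..<t]))"
  using assms(2)
proof (induction t)
  case 0
  show ?case by (auto simp: sum_profile_def copies_def)
next
  case (Suc t)
  have "sum_profile (copies (Suc t) G) (concat (map L [0..<t]) @ L t) (concat (map S [0..<t]) @ S t)"
  proof (rule sum_profile_union[of "copies t G" G id "Pair t"])
    show "sum_profile (copies t G) (concat (map L [0..<t])) (concat (map S [0..<t]))"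
      using Suc by simp
  qed (use assms(1) Suc.prems simple_graph_copies in \<open>auto simp: copies_def inj_on_def less_Suc_eq\<close>)
  then show ?case by simp
qed

lemma sum_profile_path3: "sum_profile (path_graph 3) [x, y] [x, x + y, y]"
proof -
  have V: "verts (path_graph 3) = {0, 1, 2}" by (auto simp: path_graph_def)
  have E: "edges (path_graph 3) = {{0, 1}, {1, 2}}"
    by (auto simp: path_graph_def numeral_3_eq_3 less_Suc_eq numeral_2_eq_2)
  have "{e \<in> edges (path_graph 3). 0 \<in> e} = {{0, 1}}"
       "{e \<in> edges (path_graph 3). Suc 0 \<in> e} = {{0, 1}, {1, 2}}"
       "{e \<in> edges (path_graph 3). 2 \<in> e} = {{1, 2}}"
    by (auto simp: E)
  then show ?thesis
    unfolding sum_profile_def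
    by (intro exI[of _ "[{0, 1}, {1, 2}]"] exI[of _ "[0, 1, 2]"])
       (auto simp: V E vertex_sum_def doubleton_eq_iff)
qed

text \<open>
  A list of labels read around a cycle gives the sums at the vertices between consecutive edges
  (the inner sums) and one more sum at the vertex where the list closes up, between its last and its
  first entry. That closing sum is the one which matters when a cycle is lengthened.
\<close>

fun inner_sums :: "nat list \<Rightarrow> nat list" where
  "inner_sums (x # y # zs) = (x + y) # inner_sums (y # zs)"
| "inner_sums _ = []"

definition cyclic_sums :: "nat list \<Rightarrow> nat list" where
  "cyclic_sums xs = (last xs + hd xs) # inner_sums xs"

lemma length_inner_sums [simp]: "length (inner_sums xs) = length xs - 1"
  by (induction xs rule: inner_sums.induct) auto

lemma nth_inner_sums: "Suc i < length xs \<Longrightarrow> inner_sums xs ! i = xs ! i + xs ! Suc i"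
  by (induction xs arbitrary: i rule: inner_sums.induct) (auto simp: nth_Cons split: nat.split)

lemma sum_profile_cycle:
  assumes "3 \<le> length xs"
  shows "sum_profile (cycle_graph (length xs)) xs (cyclic_sums xs)"
proof -
  define n where "n = length xs"
  have n: "3 \<le> n" using assms n_def by simp
  define E where "E = (\<lambda>i. {i, Suc i mod n})"
  have inj: "inj_on E {..<n}"
  proof (rule inj_onI)
    fix i j assume "i \<in> {..<n}" "j \<in> {..<n}" "E i = E j"
    then show "i = j" using n
      by (cases "Suc i = n"; cases "Suc j = n") (auto simp: E_def doubleton_eq_iff)
  qed
  have G: "verts (cycle_graph n) = {..<n}" "edges (cycle_graph n) = E ` {..<n}"
    by (auto simp: cycle_graph_def E_def)
  have at_0: "{e \<in> edges (cycle_graph n). 0 \<in> e} = {E (n - 1), E 0}"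
  proof -
    have "i = 0 \<or> i = n - 1" if "i < n" "0 \<in> E i" for i
      using that by (cases "Suc i = n") (auto simp: E_def)
    then show ?thesis using n by (auto simp: G E_def)
  qed
  have at_Suc: "{e \<in> edges (cycle_graph n). Suc u \<in> e} = {E u, E (Suc u)}" if "Suc u < n" for u
  proof -
    have "i = u \<or> i = Suc u" if "i < n" "Suc u \<in> E i" for i
      using that by (cases "Suc i = n") (auto simp: E_def)
    then show ?thesis using that by (auto simp: G E_def)
  qed
  have "map (vertex_sum (cycle_graph n) f) [0..<n] = cyclic_sums xs"
    if f: "map f (map E [0..<n]) = xs" for f
  proof (rule nth_equalityI)
    show "length (map (vertex_sum (cycle_graph n) f) [0..<n]) = length (cyclic_sums xs)"
      using n by (simp add: cyclic_sums_def n_def)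
    have fE: "f (E i) = xs ! i" if "i < n" for i
      using that by (simp flip: f)
    fix v assume "v < length (map (vertex_sum (cycle_graph n) f) [0..<n])"
    then have v: "v < n" by simp
    have "vertex_sum (cycle_graph n) f v = cyclic_sums xs ! v"
    proof (cases v)
      case 0
      have "E (n - 1) \<noteq> E 0" using inj n by (auto dest: inj_onD)
      then have "vertex_sum (cycle_graph n) f 0 = xs ! (n - 1) + xs ! 0"
        using n by (simp add: vertex_sum_def at_0 fE)
      moreover have "xs \<noteq> []" using n n_def by auto
      ultimately show ?thesis
        using 0 by (simp add: cyclic_sums_def last_conv_nth hd_conv_nth n_def)
    next
      case (Suc u)
      have "E u \<noteq> E (Suc u)" using inj v Suc by (auto dest: inj_onD)
      then have "vertex_sum (cycle_graph n) f v = xs ! u + xs ! Suc u"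
        using v Suc by (simp add: vertex_sum_def at_Suc fE)
      then show ?thesis
        using v Suc by (simp add: cyclic_sums_def n_def nth_inner_sums)
    qed
    then show "map (vertex_sum (cycle_graph n) f) [0..<n] ! v = cyclic_sums xs ! v"
      using v by simp
  qed
  then show ?thesis
    unfolding sum_profile_def n_def[symmetric]
    by (intro exI[of _ "map E [0..<n]"] exI[of _ "[0..<n]"])
       (use inj in \<open>simp add: distinct_map G atLeast0LessThan\<close>)
qed

section \<open>The counting bound\<close>

text \<open>Handshake: each edge contributes its label at both ends.\<close>

lemma sum_vertex_sum:
  assumes "simple_graph G"
  shows "(\<Sum>v\<in>verts G. vertex_sum G f v) = 2 * (\<Sum>e\<in>edges G. f e)"
proof -
  have fin: "finite (verts G)" and sub: "\<And>e. e \<in> edges G \<Longrightarrow> e \<subseteq> verts G \<and> card e = 2"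
    using assms by (auto simp: simple_graph_def)
  have "finite (edges G)"
    using sub by (intro finite_subset[OF _ finite_Pow_iff[THEN iffD2, OF fin]]) auto
  then have "(\<Sum>v\<in>verts G. vertex_sum G f v) = (\<Sum>e\<in>edges G. \<Sum>v | v \<in> verts G \<and> v \<in> e. f e)"
    unfolding vertex_sum_def using fin by (rule sum.swap_restrict[rotated])
  also have "\<dots> = (\<Sum>e\<in>edges G. 2 * f e)"
  proof (rule sum.cong[OF refl])
    fix e assume "e \<in> edges G"
    with sub have "{v \<in> verts G. v \<in> e} = e" "card e = 2" by auto
    then show "(\<Sum>v | v \<in> verts G \<and> v \<in> e. f e) = 2 * f e" by simp
  qed
  finally show ?thesis by (simp add: sum_distrib_left)
qed

lemma sum_distinct_pos_ge:
  fixes A :: "nat set"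
  assumes "finite A" "0 \<notin> A"
  shows "card A * (card A + 1) \<le> 2 * \<Sum>A"
  using assms
proof (induction rule: finite_linorder_max_induct)
  case (insert b A)
  have "A \<subseteq> {1..<b}" using insert by (auto simp: Suc_le_eq intro: gr0I)
  then have "card A \<le> b - 1" using card_mono[of "{1..<b}" A] by simp
  moreover have "b \<noteq> 0" using insert by auto
  ultimately have "card A + 1 \<le> b" by linarith
  moreover have "b \<notin> A" using insert by auto
  ultimately show ?case using insert by (simp add: algebra_simps)
qed simp

text \<open>
  Compares the least possible total of distinct positive vertex sums with the total forced by the
  handshake identity. The profile is any one with positive sums: it serves to count edges and
  vertices, and it shows that there are no isolated vertices, which makes the sums of the antimagic
  labeling positive.
\<close>

lemma antimagic_card_bound:
  assumes "simple_graph G" "antimagic G" "sum_profile G ls ss" "0 \<notin> set ss"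
  shows "length ss * (length ss + 1) \<le> 2 * (length ls * (length ls + 1))"
proof -
  let ?n = "length ss" and ?m = "length ls"
  have card: "card (edges G) = ?m" "card (verts G) = ?n"
    using sum_profile_card[OF assms(3)] by auto
  have fin: "finite (verts G)" using assms(1) by (simp add: simple_graph_def)
  \<comment> \<open>An isolated vertex would have sum 0 under every labeling, also in the given profile.\<close>
  have incident: "\<exists>e\<in>edges G. v \<in> e" if "v \<in> verts G" for v
  proof (rule ccontr)
    assume "\<not> ?thesis"
    then have "vertex_sum G g v = 0" for g
      unfolding vertex_sum_def by (intro sum.neutral) auto
    moreover obtain vs g where "set vs = verts G" "map (vertex_sum G g) vs = ss"
      using sum_profileE[OF assms(3)] by metis
    ultimately show False using that assms(4) by (metis imageI list.set_map)
  qed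
  obtain f where bij: "bij_betw f (edges G) {1..?m}"
      and inj: "inj_on (vertex_sum G f) (verts G)"
    using assms(2) card by (auto simp: antimagic_def antimagic_labeling_def inj_on_def)
  have finE: "finite (edges G)" using bij bij_betw_finite by blast
  have pos: "0 < f e" if "e \<in> edges G" for e using bij that by (force simp: bij_betw_def)
  have "vertex_sum G f v \<noteq> 0" if v: "v \<in> verts G" for v
  proof -
    obtain e where "e \<in> edges G" "v \<in> e" using incident[OF v] by blast
    with pos finE show ?thesis by (auto simp: vertex_sum_def)
  qed
  then have "0 \<notin> vertex_sum G f ` verts G" by (metis imageE)
  from sum_distinct_pos_ge[OF _ this] fin
  have "?n * (?n + 1) \<le> 2 * (\<Sum>v\<in>verts G. vertex_sum G f v)"
    by (simp add: card_image[OF inj] card sum.reindex[OF inj])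
  also have "(\<Sum>v\<in>verts G. vertex_sum G f v) = 2 * \<Sum>{1..?m}"
    using sum.reindex_bij_betw[OF bij, of "\<lambda>x. x"] by (simp add: sum_vertex_sum[OF assms(1)])
  also have "2 * \<Sum>{1..?m} = ?m * (?m + 1)"
    using double_gauss_sum_from_Suc_0[of ?m, where 'a = nat] by simp
  finally show ?thesis .
qed

section \<open>Adding copies of the three-vertex path\<close>

definition path3_labels :: "(nat \<times> nat) list \<Rightarrow> nat list" where
  "path3_labels ps = concat (map (\<lambda>(x, y). [x, y]) ps)"

definition path3_sums :: "(nat \<times> nat) list \<Rightarrow> nat list" where
  "path3_sums ps = concat (map (\<lambda>(x, y). [x, x + y, y]) ps)"

lemma simple_graph_copies_path3: "simple_graph (copies t (path_graph 3))"
  by (intro simple_graph_copies simple_graph_path_graph)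

lemma sum_profile_copies_path3:
  "sum_profile (copies (length ps) (path_graph 3)) (path3_labels ps) (path3_sums ps)"
proof -
  have "sum_profile (copies (length ps) (path_graph 3))
      (concat (map (\<lambda>i. (\<lambda>(x, y). [x, y]) (ps ! i)) [0..<length ps]))
      (concat (map (\<lambda>i. (\<lambda>(x, y). [x, x + y, y]) (ps ! i)) [0..<length ps]))"
    by (intro sum_profile_copies)
       (auto simp: simple_graph_path_graph sum_profile_path3 split: prod.split)
  moreover have "map (\<lambda>i. g (ps ! i)) [0..<length ps] = map g ps" for g :: "_ \<Rightarrow> nat list"
    by (metis (no_types, lifting) map_map map_nth comp_def map_eq_conv)
  ultimately show ?thesis by (simp only: path3_labels_def path3_sums_def)
qed

text \<open>
  With \<open>m\<close> edges and \<open>m\<close> vertices in \<open>G\<close>, this is \<open>V (V + 1) \<le> 2 N (N + 1)\<close> for \<open>V = m + 3 t\<close> and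
  \<open>N = m + 2 t\<close> after cancellation.
\<close>

lemma path3_copies_bound:
  assumes "simple_graph G" "sum_profile G ls ss" "0 \<notin> set ss" "length ls = length ss"
    and "antimagic (disj_union G (copies t (path_graph 3)))"
  shows "t * t \<le> 2 * length ss * t + length ss * length ss + length ss + t"
proof -
  let ?ps = "replicate t (1, 1)"
  have len: "length (path3_labels ?ps) = 2 * t" "length (path3_sums ?ps) = 3 * t"
    and pos: "0 \<notin> set (path3_sums ?ps)"
    by (induction t) (auto simp: path3_labels_def path3_sums_def)
  have "sum_profile (disj_union G (copies t (path_graph 3)))
      (ls @ path3_labels ?ps) (ss @ path3_sums ?ps)"
    using sum_profile_disj_union[OF assms(1) simple_graph_copies_path3 assms(2)
        sum_profile_copies_path3[of ?ps]] by simp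
  from antimagic_card_bound[OF simple_graph_disj_union[OF assms(1) simple_graph_copies_path3]
      assms(5) this]
  show ?thesis using assms(3,4) pos len by (simp add: algebra_simps)
qed

section \<open>Lengthening a labeled cycle\<close>

text \<open>
  The labels \<open>as\<close> lie on a cycle, and \<open>ls\<close> and \<open>ss\<close> are the labels and vertex sums of the
  remaining components. The last cycle edge carries the largest label, and the closing sum, at one
  of its ends, exceeds all other vertex sums; hence the labeling is antimagic, and the same
  properties hold again after the last edge has been subdivided.
\<close>

definition growable :: "nat list \<Rightarrow> nat list \<Rightarrow> nat list \<Rightarrow> bool" where
  "growable as ls ss \<longleftrightarrow>
     2 \<le> length as \<and> distinct (as @ ls) \<and> set (as @ ls) = {1..length (as @ ls)} \<and>
     last as = length (as @ ls) \<and>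
     distinct (inner_sums as @ ss) \<and> (\<forall>s\<in>set (inner_sums as @ ss). s < last as + hd as)"

lemma inner_sums_snoc: "xs \<noteq> [] \<Longrightarrow> inner_sums (xs @ [z]) = inner_sums xs @ [last xs + z]"
  by (induction xs rule: inner_sums.induct) auto

lemma inner_sums_rev: "inner_sums (rev xs) = rev (inner_sums xs)"
  by (induction xs rule: inner_sums.induct) (auto simp: inner_sums_snoc[of "rev _ @ [_]", simplified])

text \<open>
  Call \<open>N\<close> the last label and let \<open>v\<close> be the vertex of the closing sum, between \<open>N\<close> and the head.
  Appending \<open>N + 1\<close> subdivides the last edge. To have the largest sum in closing position again, the
  cycle has to be cut at the new vertex, between \<open>N\<close> and \<open>N + 1\<close>, and read with \<open>N + 1\<close> last:
  this is the reverse of the old list followed by \<open>N + 1\<close>. Reversal preserves the inner sums,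
  the old closing sum plus one joins them, and the new closing sum is \<open>2 N + 1\<close>.
\<close>

lemma growable_step:
  assumes "growable as ls ss"
  shows "growable (rev as @ [Suc (last as)]) ls ss"
proof -
  have "2 \<le> length as" using assms by (simp add: growable_def)
  moreover from this have "as \<noteq> []" by auto
  ultimately have as: "2 \<le> length as" "as \<noteq> []" "hd as \<in> set as" by simp_all
  \<comment> \<open>The head is below \<open>N\<close>, so the sum at \<open>v\<close> stays below the new closing sum.\<close>
  have ne: "hd as \<noteq> last as"
  proof -
    have "distinct as" using assms by (simp add: growable_def)
    then show ?thesis using as(1) by (cases as) (auto split: if_splits)
  qed
  have "hd as \<in> {1..last as}"
    using assms as(3) by (metis growable_def Un_iff set_append)
  with ne have less: "hd as < last as" by auto
  define N where "N = last as"
  have sums: "inner_sums (rev as @ [Suc N]) = rev (inner_sums as) @ [Suc (N + hd as)]"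
    using as(2) by (simp add: inner_sums_snoc inner_sums_rev last_rev)
  have len: "length ((rev as @ [Suc N]) @ ls) = Suc N"
    and set: "set as \<union> set ls = {1..N}"
    using assms by (simp_all add: growable_def N_def)
  have small: "s < N + hd as" if "s \<in> set (inner_sums as @ ss)" for s
    using assms that unfolding growable_def N_def by blast
  have "Suc N \<notin> set as \<union> set ls" unfolding set by simp
  moreover have "Suc (N + hd as) \<notin> set (inner_sums as @ ss)"
    using small[of "Suc (N + hd as)"] by auto
  moreover have "s < Suc N + N" if "s \<in> set (inner_sums as @ ss) \<union> {Suc (N + hd as)}" for s
    using small[of s] that less by (auto simp: N_def)
  moreover have "set ((rev as @ [Suc N]) @ ls) = {1..Suc N}"
    using set by (auto simp: atLeastAtMostSuc_conv)
  moreover have "hd (rev as @ [Suc N]) = N" using as(2) by (simp add: N_def hd_rev)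
  ultimately show ?thesis
    using assms as(1)
    unfolding growable_def len sums N_def[symmetric] by auto
qed

lemma growable_all_lengths:
  assumes "growable as ls ss" "length as \<le> n"
  shows "\<exists>as'. length as' = n \<and> growable as' ls ss"
  using assms(2)
proof (induction n rule: dec_induct)
  case base
  then show ?case using assms(1) by blast
next
  case (step n)
  then obtain as' where "length as' = n" "growable as' ls ss" by blast
  then show ?case by (intro exI[of _ "rev as' @ [Suc (last as')]"]) (simp add: growable_step)
qed

section \<open>Labelings of two triangles and at most fifteen paths\<close>

text \<open>
  For each \<open>t\<close> from 0 to 15 the labels of the first triangle, of the second triangle, and of the two
  edges of each of \<open>t\<close> paths, found by a search over random labels of the triangles with
  backtracking over the pairs. For large \<open>t\<close> there is little freedom: for \<open>t = 15\<close> the total of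
  the vertex sums is \<open>36 * 37 = 1332\<close>, while 51 distinct positive integers have at least the total
  1326.
\<close>

definition seeds :: "(nat list \<times> nat list \<times> (nat \<times> nat) list) list" where
  "seeds = [
    ([5, 4, 6], [1, 2, 3],
     []),
    ([6, 2, 8], [7, 4, 5],
     [(1, 3)]),
    ([9, 6, 10], [5, 4, 7],
     [(1, 3), (2, 8)]),
    ([10, 1, 12], [5, 11, 7],
     [(2, 8), (3, 4), (6, 9)]),
    ([13, 7, 14], [10, 5, 12],
     [(1, 9), (2, 11), (3, 4), (6, 8)]),
    ([10, 4, 16], [2, 14, 8],
     [(1, 3), (5, 12), (6, 13), (7, 11), (9, 15)]),
    ([16, 7, 18], [12, 14, 17],
     [(1, 13), (2, 10), (3, 4), (5, 11), (6, 15), (8, 9)]),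
    ([18, 14, 20], [11, 15, 10],
     [(1, 9), (2, 13), (3, 17), (4, 7), (5, 19), (6, 8), (12, 16)]),
    ([15, 13, 22], [16, 7, 20],
     [(1, 12), (2, 5), (3, 17), (4, 11), (6, 19), (8, 18), (9, 21), (10, 14)]),
    ([13, 1, 24], [18, 14, 16],
     [(2, 11), (3, 15), (4, 12), (5, 22), (6, 20), (7, 17), (8, 21), (9, 19), (10, 23)]),
    ([19, 13, 26], [6, 16, 22],
     [(1, 5), (2, 14), (3, 10), (4, 25), (7, 12), (8, 18), (9, 21), (11, 23), (15, 20),
      (17, 24)]),
    ([18, 15, 28], [25, 17, 19],
     [(1, 24), (2, 26), (3, 14), (4, 27), (5, 10), (6, 12), (7, 23), (8, 11), (9, 20),
      (13, 21), (16, 22)]),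
    ([21, 9, 30], [26, 15, 23],
     [(1, 22), (2, 7), (3, 28), (4, 17), (5, 10), (6, 27), (8, 18), (11, 25), (12, 20),
      (13, 24), (14, 29), (16, 19)]),
    ([23, 13, 32], [16, 27, 7],
     [(1, 15), (2, 31), (3, 4), (5, 8), (6, 26), (9, 29), (10, 17), (11, 30), (12, 25),
      (14, 21), (18, 24), (19, 20), (22, 28)]),
    ([21, 17, 34], [14, 23, 25],
     [(1, 33), (2, 12), (3, 20), (4, 31), (5, 16), (6, 19), (7, 10), (8, 28), (9, 32),
      (11, 29), (13, 30), (15, 27), (18, 26), (22, 24)]),
    ([18, 6, 36], [24, 20, 26],
     [(1, 25), (2, 4), (3, 35), (5, 13), (7, 29), (8, 32), (9, 11), (10, 33), (12, 27),
      (14, 31), (15, 34), (16, 21), (17, 30), (19, 22), (23, 28)])]"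

lemma length_seeds: "map (\<lambda>(as, bs, ps). length ps) seeds = [0..<16]"
  by code_simp

lemma growable_seeds:
  "list_all (\<lambda>(as, bs, ps). length as = 3 \<and> length bs = 3 \<and>
     growable as (bs @ path3_labels ps) (cyclic_sums bs @ path3_sums ps)) seeds"
  by code_simp

lemma ex_growable:
  assumes "3 \<le> n" "t \<le> 15"
  shows "\<exists>as bs ps. length as = n \<and> length bs = 3 \<and> length ps = t \<and>
    growable as (bs @ path3_labels ps) (cyclic_sums bs @ path3_sums ps)"
proof -
  have "t \<in> set (map (\<lambda>(as, bs, ps). length ps) seeds)"
    using assms(2) by (simp add: length_seeds)
  then obtain as bs ps where "(as, bs, ps) \<in> set seeds" "length ps = t" by auto
  moreover from this have "length as = 3" "length bs = 3"
      "growable as (bs @ path3_labels ps) (cyclic_sums bs @ path3_sums ps)"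
    using growable_seeds by (auto simp: list_all_iff)
  ultimately show ?thesis using growable_all_lengths assms(1) by metis
qed

lemma growable_imp:
  assumes "growable as ls ss"
  shows "distinct (as @ ls)" "set (as @ ls) = {1..length (as @ ls)}"
    "distinct (cyclic_sums as @ ss)"
  using assms by (auto simp: growable_def cyclic_sums_def)

section \<open>A cycle and a triangle with added paths\<close>

text \<open>
  The hypothesis \<open>profile\<close> is what the argument uses of \<open>G\<close> being the disjoint union of a cycle of
  length \<open>n\<close> and a triangle. It does not depend on the names of the vertices, so that it covers
  the union formed by \<^const>\<open>disj_union\<close> as well as the one formed by \<^const>\<open>copies\<close>.
\<close>

lemma antimagic_two_cycles:
  assumes "simple_graph G" "3 \<le> n" "t \<le> 15"
    and profile: "\<And>as bs. length as = n \<Longrightarrow> length bs = 3 \<Longrightarrow>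
      sum_profile G (as @ bs) (cyclic_sums as @ cyclic_sums bs)"
  shows "antimagic (disj_union G (copies t (path_graph 3)))"
proof -
  obtain as bs ps where *: "length as = n" "length bs = 3" "length ps = t"
      "growable as (bs @ path3_labels ps) (cyclic_sums bs @ path3_sums ps)"
    using ex_growable[OF assms(2,3)] by blast
  have "sum_profile (disj_union G (copies t (path_graph 3)))
      (as @ bs @ path3_labels ps) (cyclic_sums as @ cyclic_sums bs @ path3_sums ps)"
    using sum_profile_disj_union[OF assms(1) simple_graph_copies_path3 profile[OF *(1,2)]
        sum_profile_copies_path3[of ps]] *(3) by simp
  from antimagic_if_sum_profile[OF this growable_imp[OF *(4)]] show ?thesis .
qed

lemma antimagic_two_cycles_alone:
  assumes "3 \<le> n"
    and profile: "\<And>as bs. length as = n \<Longrightarrow> length bs = 3 \<Longrightarrow>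
      sum_profile G (as @ bs) (cyclic_sums as @ cyclic_sums bs)"
  shows "antimagic G"
proof -
  obtain as bs ps where "length as = n" "length bs = 3" "length ps = 0"
      "growable as (bs @ path3_labels ps) (cyclic_sums bs @ path3_sums ps)"
    using ex_growable[OF assms(1), of 0] by blast
  then have *: "length as = n" "length bs = 3" "growable as bs (cyclic_sums bs)"
    by (simp_all add: path3_labels_def path3_sums_def)
  from antimagic_if_sum_profile[OF profile[OF *(1,2)] growable_imp[OF *(3)]] show ?thesis .
qed

lemma cyclic_sums_replicate: "0 < n \<Longrightarrow> cyclic_sums (replicate n c) = replicate n (2 * c)"
proof -
  have "inner_sums (replicate (Suc k) c) = replicate k (2 * c)" for k
    by (induction k) auto
  then show "0 < n \<Longrightarrow> ?thesis" by (cases n) (auto simp: cyclic_sums_def)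
qed

text \<open>
  Labeling all edges of both cycles with 1 gives every vertex the sum 2, so there are as many
  vertices as edges, namely \<open>n + 3\<close>.
\<close>

lemma two_cycles_bound:
  assumes "simple_graph G" "3 \<le> n"
    and profile: "\<And>as bs. length as = n \<Longrightarrow> length bs = 3 \<Longrightarrow>
      sum_profile G (as @ bs) (cyclic_sums as @ cyclic_sums bs)"
    and "antimagic (disj_union G (copies t (path_graph 3)))"
  shows "t * t \<le> 2 * (n + 3) * t + (n + 3) * (n + 3) + (n + 3) + t"
proof -
  have "sum_profile G (replicate (n + 3) 1) (replicate (n + 3) 2)"
    using profile[of "replicate n 1" "replicate 3 1"] assms(2)
    by (simp add: cyclic_sums_replicate replicate_add)
  from path3_copies_bound[OF assms(1) this _ _ assms(4)] show ?thesis by simp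
qed

text \<open>The bound \<open>b\<close> guarantees that the maximum in the definition of \<^const>\<open>tau\<close> exists.\<close>

lemma tau_ge:
  assumes "antimagic G" "\<And>t. t \<le> k \<Longrightarrow> antimagic (disj_union G (copies t (path_graph 3)))"
    and "\<And>t. antimagic (disj_union G (copies t (path_graph 3))) \<Longrightarrow> t \<le> b"
  shows "ereal (real k) \<le> tau G"
proof -
  have "k \<le> (GREATEST t. \<forall>t'\<le>t. antimagic (disj_union G (copies t' (path_graph 3))))"
    by (rule Greatest_le_nat[where b = b]) (use assms(2,3) in auto)
  then show ?thesis using assms(1) by (simp add: tau_def)
qed

lemma tau_eq:
  assumes "antimagic G" "\<And>t. t \<le> k \<Longrightarrow> antimagic (disj_union G (copies t (path_graph 3)))"
    and "\<not> antimagic (disj_union G (copies (Suc k) (path_graph 3)))"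
  shows "tau G = ereal (real k)"
proof -
  have "(GREATEST t. \<forall>t'\<le>t. antimagic (disj_union G (copies t' (path_graph 3)))) = k"
    by (rule Greatest_equality) (use assms(2,3) not_less_eq_eq in auto)
  then show ?thesis using assms(1) by (simp add: tau_def)
qed

section \<open>The values for a cycle and a triangle, and for two triangles\<close>

lemma tau_cycle_triangle_ge:
  assumes "3 \<le> n"
  shows "15 \<le> tau (disj_union (cycle_graph n) (cycle_graph 3))"
proof -
  let ?G = "disj_union (cycle_graph n) (cycle_graph 3)"
  have simple: "simple_graph ?G"
    using assms by (intro simple_graph_disj_union simple_graph_cycle_graph) auto
  have profile: "sum_profile ?G (as @ bs) (cyclic_sums as @ cyclic_sums bs)"
    if "length as = n" "length bs = 3" for as bs
    using that assms sum_profile_cycle[of as] sum_profile_cycle[of bs]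
    by (intro sum_profile_disj_union simple_graph_cycle_graph) auto
  have "t \<le> 3 * (n + 3)" if "antimagic (disj_union ?G (copies t (path_graph 3)))" for t
  proof (rule ccontr)
    let ?m = "n + 3"
    \<comment> \<open>For \<open>t \<ge> 3 m + 1\<close> already \<open>t (t - 2 m - 1) \<ge> (3 m + 1) m > m (m + 1)\<close>.\<close>
    assume "\<not> t \<le> 3 * ?m"
    then obtain d where d: "t = 3 * ?m + 1 + d" by (metis add.commute add_Suc_right
          less_natE not_le plus_1_eq_Suc)
    have "t * t \<le> 2 * ?m * t + ?m * ?m + ?m + t"
      using two_cycles_bound[OF simple assms profile that] .
    then show False by (simp add: d algebra_simps)
  qed
  from tau_ge[OF antimagic_two_cycles_alone[OF assms profile]
      antimagic_two_cycles[OF simple assms _ profile] this, of 15]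
  show ?thesis by simp
qed

lemma simple_graph_two_triangles: "simple_graph (copies 2 (cycle_graph 3))"
  by (intro simple_graph_copies simple_graph_cycle_graph) simp

lemma sum_profile_two_triangles:
  assumes "length as = 3" "length bs = 3"
  shows "sum_profile (copies 2 (cycle_graph 3)) (as @ bs) (cyclic_sums as @ cyclic_sums bs)"
proof -
  have "sum_profile (cycle_graph 3) ([as, bs] ! i) (cyclic_sums ([as, bs] ! i))" if "i < 2" for i
    using that assms sum_profile_cycle[of as] sum_profile_cycle[of bs]
    by (auto simp: less_2_cases_iff)
  from sum_profile_copies[of "cycle_graph 3" 2 "\<lambda>i. [as, bs] ! i" "\<lambda>i. cyclic_sums ([as, bs] ! i)",
      OF simple_graph_cycle_graph this]
  show ?thesis by (simp add: numeral_2_eq_2)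
qed

lemma tau_two_triangles: "tau (copies 2 (cycle_graph 3)) = 15"
proof -
  have "\<not> antimagic (disj_union (copies 2 (cycle_graph 3)) (copies (Suc 15) (path_graph 3)))"
    using two_cycles_bound[of "copies 2 (cycle_graph 3)" 3 "Suc 15"] simple_graph_two_triangles
      sum_profile_two_triangles by auto
  moreover have "antimagic (copies 2 (cycle_graph 3))"
    by (rule antimagic_two_cycles_alone[of 3]) (simp_all add: sum_profile_two_triangles)
  moreover have "antimagic (disj_union (copies 2 (cycle_graph 3)) (copies t (path_graph 3)))"
    if "t \<le> 15" for t
    by (rule antimagic_two_cycles[of _ 3])
       (simp_all add: simple_graph_two_triangles sum_profile_two_triangles that)
  ultimately have "tau (copies 2 (cycle_graph 3)) = ereal (real 15)"
    by (intro tau_eq)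
  then show ?thesis by simp
qed

text \<open>
  Two distinct vertices in one component lie on the same triangle. This separates the components
  from the three-vertex path, whose ends are not adjacent, without determining the components.
\<close>

lemma two_triangles_adjacent:
  assumes "reachable (copies 2 (cycle_graph 3)) u x" "reachable (copies 2 (cycle_graph 3)) u y"
    and "x \<in> verts (copies 2 (cycle_graph 3))" "y \<in> verts (copies 2 (cycle_graph 3))" "x \<noteq> y"
  shows "{x, y} \<in> edges (copies 2 (cycle_graph 3))"
proof -
  have "fst w = fst u" if "reachable (copies 2 (cycle_graph 3)) u w" for w
    using that unfolding reachable_def
  proof induction
    case (step v w)
    then obtain i e where "{v, w} = Pair i ` e" by (auto simp: copies_def)
    then have "v \<in> Pair i ` e" "w \<in> Pair i ` e" by blast+
    with step.IH show ?case by auto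
  qed simp
  with assms(1,2) have "fst x = fst y" by metis
  then obtain i a b where xy: "x = (i, a)" "y = (i, b)" by (metis prod.collapse)
  with assms have "i < 2" "a < 3" "b < 3" "a \<noteq> b" by (auto simp: copies_def cycle_graph_def)
  have "{..<3} = {0, 1, 2::nat}" by auto
  then have "edges (cycle_graph 3) = {{0, 1}, {1, 2}, {2, 0}}"
    by (simp add: numeral_2_eq_2 cycle_graph_def setcompr_eq_image flip: lessThan_def)
  moreover have "a \<in> {0, 1, 2}" "b \<in> {0, 1, 2}" using \<open>a < 3\<close> \<open>b < 3\<close> by auto
  ultimately have "{a, b} \<in> edges (cycle_graph 3)"
    using \<open>a \<noteq> b\<close> by (elim insertE emptyE) (simp_all add: insert_commute)
  moreover have "Pair i ` e \<in> edges (copies 2 G)" if "e \<in> edges G" for e and G :: "nat ugraph"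
    using that \<open>i < 2\<close> by (auto simp: copies_def)
  ultimately have "Pair i ` {a, b} \<in> edges (copies 2 (cycle_graph 3))" by blast
  then show ?thesis by (simp add: xy)
qed

lemma two_triangles_no_path3_component:
  "{C \<in> graph_components (copies 2 (cycle_graph 3)). graph_iso C (path_graph 3)} = {}"
proof -
  let ?G = "copies 2 (cycle_graph 3)"
  have False if "C \<in> graph_components ?G" "graph_iso C (path_graph 3)" for C
  proof -
    obtain u where C: "verts C = {v \<in> verts ?G. reachable ?G u v}"
        "edges C = {e \<in> edges ?G. e \<subseteq> verts C}"
      using \<open>C \<in> graph_components ?G\<close>
      by (auto simp: graph_components_def induced_subgraph_def)
    obtain h where h: "bij_betw h (verts C) {..<3::nat}"
        "edges (path_graph 3) = (`) h ` edges C"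
      using \<open>graph_iso C (path_graph 3)\<close> by (auto simp: graph_iso_def path_graph_def)
    have "0 \<in> h ` verts C" "2 \<in> h ` verts C" using h(1) by (auto simp: bij_betw_def)
    then obtain x y where xy: "x \<in> verts C" "y \<in> verts C" "h x = 0" "h y = 2" by force
    then have "x \<noteq> y" by auto
    with xy have "{x, y} \<in> edges C" using two_triangles_adjacent[of u x y] by (auto simp: C)
    then have "h ` {x, y} \<in> edges (path_graph 3)" unfolding h(2) by (rule imageI)
    then have "{0, 2} \<in> edges (path_graph 3)" by (simp add: xy)
    then show False by (auto simp: path_graph_def doubleton_eq_iff)
  qed
  then show ?thesis by blast
qed

text \<open>
  All six edges are internal, so the second term of the minimum is 43. As \<open>m = n = 6\<close>, the first
  one is \<open>6.5 * (1 + sqrt 2)\<close>, about 15.69, and it decides.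
\<close>

lemma beta_two_triangles: "beta (copies 2 (cycle_graph 3)) = 15"
proof -
  let ?G = "copies 2 (cycle_graph 3)"
  have profile: "sum_profile ?G (replicate 6 1) (replicate 6 2)"
    using sum_profile_two_triangles[of "replicate 3 1" "replicate 3 1"]
    by (simp add: cyclic_sums_replicate flip: replicate_add)
  have card: "card (edges ?G) = 6" "card (verts ?G) = 6"
    using sum_profile_card[OF profile] by simp_all
  have "degree ?G ` verts ?G = {2}"
    using degrees_if_sum_profile[OF profile] by simp
  then have "degree ?G v = 2" if "v \<in> verts ?G" for v using that by blast
  then have "\<not> leaf ?G v" for v by (auto simp: leaf_def)
  then have "internal_edges ?G = edges ?G" by (simp add: internal_edges_def)
  moreover have "14 / 10 \<le> sqrt 2" "sqrt 2 \<le> 14143 / 10000"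
    by (rule real_le_rsqrt real_le_lsqrt; simp add: power2_eq_square)+
  ultimately show ?thesis
    using card by (simp add: beta_def two_triangles_no_path3_component floor_eq_iff min_def)
qed

theorem theorem23:
  "(\<forall>n::nat. n \<ge> 3 \<longrightarrow> tau (disj_union (cycle_graph n) (cycle_graph 3)) \<ge> 15) \<and>
   tau (copies 2 (cycle_graph 3)) = ereal (real_of_int (beta (copies 2 (cycle_graph 3)))) \<and>
   beta (copies 2 (cycle_graph 3)) = 15"
  using tau_cycle_triangle_ge tau_two_triangles beta_two_triangles by simp

end
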